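(* Let $p$ be an odd prime. For any positive integers $i, n$, $$\mathrm{St}^{\Delta_i}V_n=(-1)^{n-1}\,[0,1,\ldots,n-2,i]\,L_{n-1}^{p-2}.$$
   Context: $P_n=E(x_1,\ldots,x_n)\otimes\mathbb F_p[y_1,\ldots,y_n]$ (exterior tensor polynomial algebra), graded by $\dim x_j=1$, $\dim y_j=2$, with the usual action of the mod $p$ Steenrod algebra $\mathcal A(p)$. For $i\ge1$, $\mathrm{St}^{\Delta_i}\in\mathcal A(p)$ is the primitive Steenrod–Milnor operation dual to $\xi_i$ with respect to the Milnor monomial basis of $\mathcal A(p)^*$. By the Cartan formula its action on $P_n$ is the $\mathbb F_p$-linear derivation determined by $\mathrm{St}^{\Delta_i}(x_j)=0$, $\mathrm{St}^{\Delta_i}(y_j)=y_j^{p^i}$. For nonnegative integers $e_1,\ldots,e_m$, $[e_1,\ldots,e_m]=\det\big(y_a^{p^{e_b}}\big)_{1\le a,b\le m}\in\mathbb F_p[y_1,\ldots,y_m]$. Put $L_m=[0,1,\ldots,m-1]$ for $m\ge1$ and $L_0=1$ by convention. The Mùi invariant $V_n$ is $V_n=L_n/L_{n-1}$ (a polynomial in $y_1,\ldots,y_n$). For $n=1$, $[0,1,\ldots,n-2,i]$ means $[i]=y_1^{p^i}$. *)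

theory Defs
  imports
    "Jordan_Normal_Form.Determinant"
    "Berlekamp_Zassenhaus.Finite_Field"
    "HOL-Library.Poly_Mapping"
    "HOL-Library.FuncSet"
begin

section \<open>Exterior algebras on countably many generators\<close>

text \<open>
  An element of the exterior algebra over a commutative ring \<open>'r\<close> on generators
  $x_0, x_1, \dots$ is the finitely supported family of its coefficients at the monomials
  $x_S = x_{s_1} \cdots x_{s_k}$, where $S = \{s_1 < \dots < s_k\}$.
\<close>

typedef (overloaded) 'r exterior =
  "{f :: nat set \<Rightarrow> 'r::zero. finite {S. f S \<noteq> 0} \<and> (\<forall>S. f S \<noteq> 0 \<longrightarrow> finite S)}"
  morphisms ecoeff Abs_exterior
  by (rule exI[of _ "\<lambda>_. 0"]) simp

setup_lifting type_definition_exterior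

text \<open>
  The sign of the permutation that sorts the concatenation of the increasing lists of
  elements of \<open>S\<close> and \<open>T\<close>, so that $x_S x_T = \mathrm{sgn}(S,T)\, x_{S \cup T}$ for
  disjoint \<open>S\<close> and \<open>T\<close>.
\<close>

definition shuffle_sign :: "nat set \<Rightarrow> nat set \<Rightarrow> 'r::comm_ring_1" where
  "shuffle_sign S T = (-1) ^ card {(s, t). s \<in> S \<and> t \<in> T \<and> t < s}"

lemma ecoeff_finite: "finite {S. ecoeff f S \<noteq> 0}"
  using ecoeff[of f] by simp

lemma ecoeff_infinite: "infinite S \<Longrightarrow> ecoeff f S = 0"
  using ecoeff[of f] by auto

lemma exterior_eqI: "(\<And>S. finite S \<Longrightarrow> ecoeff f S = ecoeff g S) \<Longrightarrow> f = g"
  by (metis ecoeff_infinite ecoeff_inject ext)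

instantiation exterior :: (comm_ring_1) ring_1
begin

lift_definition zero_exterior :: "'a exterior" is "\<lambda>_. 0" by simp

lift_definition one_exterior :: "'a exterior" is "\<lambda>S. if S = {} then 1 else 0" by simp

lift_definition plus_exterior :: "'a exterior \<Rightarrow> 'a exterior \<Rightarrow> 'a exterior"
  is "\<lambda>f g S. f S + g S"
proof -
  fix f g :: "nat set \<Rightarrow> 'a"
  assume a: "finite {S. f S \<noteq> 0} \<and> (\<forall>S. f S \<noteq> 0 \<longrightarrow> finite S)"
    and b: "finite {S. g S \<noteq> 0} \<and> (\<forall>S. g S \<noteq> 0 \<longrightarrow> finite S)"
  have "{S. f S + g S \<noteq> 0} \<subseteq> {S. f S \<noteq> 0} \<union> {S. g S \<noteq> 0}" by auto
  then have "finite {S. f S + g S \<noteq> 0}" using a b by (meson finite_UnI finite_subset)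
  moreover have "finite S" if "f S + g S \<noteq> 0" for S
    using that a b by (metis add.right_neutral)
  ultimately show "finite {S. f S + g S \<noteq> 0} \<and> (\<forall>S. f S + g S \<noteq> 0 \<longrightarrow> finite S)" by blast
qed

lift_definition uminus_exterior :: "'a exterior \<Rightarrow> 'a exterior" is "\<lambda>f S. - f S"
  by simp

definition minus_exterior :: "'a exterior \<Rightarrow> 'a exterior \<Rightarrow> 'a exterior"
  where "f - g = f + - g" for f g :: "'a exterior"

lift_definition times_exterior :: "'a exterior \<Rightarrow> 'a exterior \<Rightarrow> 'a exterior"
  is "\<lambda>f g U. \<Sum>S\<in>Pow U. shuffle_sign S (U - S) * f S * g (U - S)"
proof -
  fix f g :: "nat set \<Rightarrow> 'a"
  assume a: "finite {S. f S \<noteq> 0} \<and> (\<forall>S. f S \<noteq> 0 \<longrightarrow> finite S)"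
    and b: "finite {S. g S \<noteq> 0} \<and> (\<forall>S. g S \<noteq> 0 \<longrightarrow> finite S)"
  let ?h = "\<lambda>U. \<Sum>S\<in>Pow U. shuffle_sign S (U - S) * f S * g (U - S)"
  have ex: "\<exists>S\<in>Pow U. f S \<noteq> 0 \<and> g (U - S) \<noteq> 0" if "?h U \<noteq> 0" for U
    using that by (metis (no_types, lifting) mult_not_zero sum.not_neutral_contains_not_neutral)
  have "{U. ?h U \<noteq> 0} \<subseteq> (\<lambda>(S, T). S \<union> T) ` ({S. f S \<noteq> 0} \<times> {S. g S \<noteq> 0})"
  proof
    fix U assume "U \<in> {U. ?h U \<noteq> 0}"
    then obtain S where "S \<subseteq> U" "f S \<noteq> 0" "g (U - S) \<noteq> 0" using ex by blast
    then have "U = (\<lambda>(S, T). S \<union> T) (S, U - S)"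
      "(S, U - S) \<in> {S. f S \<noteq> 0} \<times> {S. g S \<noteq> 0}" by auto
    then show "U \<in> (\<lambda>(S, T). S \<union> T) ` ({S. f S \<noteq> 0} \<times> {S. g S \<noteq> 0})" by (rule image_eqI)
  qed
  then have "finite {U. ?h U \<noteq> 0}"
    using a b by (meson finite_SigmaI finite_imageI finite_subset)
  moreover have "finite U" if "?h U \<noteq> 0" for U
    using ex[OF that] a b by (metis PowD finite_Diff2)
  ultimately show "finite {U. ?h U \<noteq> 0} \<and> (\<forall>U. ?h U \<noteq> 0 \<longrightarrow> finite U)" by blast
qed

lemma shuffle_sign_union_left:
  assumes "finite S" "finite S'" "finite T" "S \<inter> S' = {}"
  shows "shuffle_sign (S \<union> S') T = (shuffle_sign S T * shuffle_sign S' T :: 'a)"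
proof -
  have e: "{(s, t). s \<in> S \<union> S' \<and> t \<in> T \<and> t < s} =
    {(s, t). s \<in> S \<and> t \<in> T \<and> t < s} \<union> {(s, t). s \<in> S' \<and> t \<in> T \<and> t < s}" by auto
  have f: "finite {(s, t). s \<in> A \<and> t \<in> T \<and> t < s}" if "finite A" for A :: "nat set"
    by (rule finite_subset[of _ "A \<times> T"]) (use that assms in auto)
  show ?thesis unfolding shuffle_sign_def e
    by (subst card_Un_disjoint) (use f assms in \<open>auto simp: power_add\<close>)
qed

lemma shuffle_sign_union_right:
  assumes "finite S" "finite T" "finite T'" "T \<inter> T' = {}"
  shows "shuffle_sign S (T \<union> T') = (shuffle_sign S T * shuffle_sign S T' :: 'a)"
proof -
  have e: "{(s, t). s \<in> S \<and> t \<in> T \<union> T' \<and> t < s} =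
    {(s, t). s \<in> S \<and> t \<in> T \<and> t < s} \<union> {(s, t). s \<in> S \<and> t \<in> T' \<and> t < s}" by auto
  have f: "finite {(s, t). s \<in> S \<and> t \<in> A \<and> t < s}" if "finite A" for A :: "nat set"
    by (rule finite_subset[of _ "S \<times> A"]) (use that assms in auto)
  show ?thesis unfolding shuffle_sign_def e
    by (subst card_Un_disjoint) (use f assms in \<open>auto simp: power_add\<close>)
qed

lemma exterior_mult_assoc: "(f * g) * h = f * (g * h)" for f g h :: "'a exterior"
proof (rule exterior_eqI)
  fix U :: "nat set" assume U: "finite U"
  have fin: "finite S" if "S \<subseteq> U" for S using U that finite_subset by blast
  have "ecoeff ((f * g) * h) U =
    (\<Sum>A\<in>Pow U. \<Sum>B\<in>Pow A. shuffle_sign A (U - A) * shuffle_sign B (A - B)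
      * ecoeff f B * ecoeff g (A - B) * ecoeff h (U - A))"
    by (simp add: times_exterior.rep_eq sum_distrib_left sum_distrib_right algebra_simps)
  also have "\<dots> = (\<Sum>(A, B)\<in>Sigma (Pow U) Pow. shuffle_sign A (U - A) * shuffle_sign B (A - B)
      * ecoeff f B * ecoeff g (A - B) * ecoeff h (U - A))"
    by (rule sum.Sigma) (use U fin in auto)
  also have "\<dots> = (\<Sum>(B, C)\<in>Sigma (Pow U) (\<lambda>B. Pow (U - B)).
      shuffle_sign B (U - B) * shuffle_sign C (U - B - C)
      * ecoeff f B * ecoeff g C * ecoeff h (U - B - C))"
  proof (rule sum.reindex_bij_witness[of _ "\<lambda>(B, C). (B \<union> C, B)" "\<lambda>(A, B). (B, A - B)"];
      clarsimp)
    fix A B assume AU: "A \<subseteq> U" and BA: "B \<subseteq> A"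
    let ?C = "A - B" and ?D = "U - A"
    have D: "U - B - ?C = ?D" using AU BA by auto
    have "shuffle_sign A ?D = (shuffle_sign (B \<union> ?C) ?D :: 'a)" using BA by (simp add: Un_absorb1)
    also have "\<dots> = shuffle_sign B ?D * shuffle_sign ?C ?D"
      by (rule shuffle_sign_union_left) (use AU BA fin in auto)
    finally have 1: "shuffle_sign A ?D = (shuffle_sign B ?D * shuffle_sign ?C ?D :: 'a)" .
    have "U - B = ?C \<union> ?D" using AU BA by auto
    then have "shuffle_sign B (U - B) = (shuffle_sign B (?C \<union> ?D) :: 'a)" by simp
    also have "\<dots> = shuffle_sign B ?C * shuffle_sign B ?D"
      by (rule shuffle_sign_union_right) (use AU BA fin in auto)
    finally have 2: "shuffle_sign B (U - B) = (shuffle_sign B ?C * shuffle_sign B ?D :: 'a)" .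
    have U_minus: "U - (B \<union> (A - B)) = ?D" using BA by auto
    show "(shuffle_sign B (U - B) :: 'a) * shuffle_sign ?C (U - B - ?C)
      * ecoeff f B * ecoeff g ?C * ecoeff h (U - B - ?C)
      = shuffle_sign A ?D * shuffle_sign B ?C * ecoeff f B * ecoeff g ?C * ecoeff h ?D"
      unfolding D 1 2 by (simp add: algebra_simps)
  qed auto
  also have "\<dots> = (\<Sum>B\<in>Pow U. \<Sum>C\<in>Pow (U - B).
      shuffle_sign B (U - B) * shuffle_sign C (U - B - C)
      * ecoeff f B * ecoeff g C * ecoeff h (U - B - C))"
    by (rule sum.Sigma[symmetric]) (use U fin in auto)
  also have "\<dots> = ecoeff (f * (g * h)) U"
    by (simp add: times_exterior.rep_eq sum_distrib_left sum_distrib_right algebra_simps)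
  finally show "ecoeff ((f * g) * h) U = ecoeff (f * (g * h)) U" .
qed

lemma shuffle_sign_empty [simp]: "shuffle_sign {} T = 1" "shuffle_sign S {} = 1"
  by (simp_all add: shuffle_sign_def)

lemma ecoeff_mult_scalar_left:
  fixes f g :: "'a exterior"
  assumes "finite U" "\<And>S. S \<noteq> {} \<Longrightarrow> ecoeff f S = 0"
  shows "ecoeff (f * g) U = ecoeff f {} * ecoeff g U"
proof -
  have "(\<Sum>S\<in>Pow U. shuffle_sign S (U - S) * ecoeff f S * ecoeff g (U - S)) =
    (\<Sum>S\<in>{{}}. shuffle_sign S (U - S) * ecoeff f S * ecoeff g (U - S))"
    by (rule sum.mono_neutral_right) (use assms in auto)
  then show ?thesis by (simp add: times_exterior.rep_eq)
qed

lemma ecoeff_mult_scalar_right: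
  fixes f g :: "'a exterior"
  assumes "finite U" "\<And>S. S \<noteq> {} \<Longrightarrow> ecoeff g S = 0"
  shows "ecoeff (f * g) U = ecoeff f U * ecoeff g {}"
proof -
  have "(\<Sum>S\<in>Pow U. shuffle_sign S (U - S) * ecoeff f S * ecoeff g (U - S)) =
    (\<Sum>S\<in>{U}. shuffle_sign S (U - S) * ecoeff f S * ecoeff g (U - S))"
    proof (rule sum.mono_neutral_right)
    have "U - S \<noteq> {}" if "S \<in> Pow U - {U}" for S using that by auto
    then show "\<forall>S\<in>Pow U - {U}. shuffle_sign S (U - S) * ecoeff f S * ecoeff g (U - S) = 0"
      using assms(2) by simp
  qed (use assms in auto)
  then show ?thesis by (simp add: times_exterior.rep_eq)
qed

instance
proof
  fix a b c :: "'a exterior"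
  show "a * b * c = a * (b * c)" by (rule exterior_mult_assoc)
  show "1 * a = a"
    by (rule exterior_eqI) (simp add: ecoeff_mult_scalar_left one_exterior.rep_eq)
  show "a * 1 = a"
    by (rule exterior_eqI) (simp add: ecoeff_mult_scalar_right one_exterior.rep_eq)
  show "(a + b) * c = a * c + b * c"
    by (rule exterior_eqI)
      (simp add: times_exterior.rep_eq plus_exterior.rep_eq algebra_simps sum.distrib)
  show "a * (b + c) = a * b + a * c"
    by (rule exterior_eqI)
      (simp add: times_exterior.rep_eq plus_exterior.rep_eq algebra_simps sum.distrib)
  show "a + b + c = a + (b + c)" "a + b = b + a" "0 + a = a" "- a + a = 0"
    by (transfer; simp add: algebra_simps)+
  show "a - b = a + - b" by (rule minus_exterior_def)
  show "(0::'a exterior) \<noteq> 1" by transfer (metis zero_neq_one)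
qed

end

lift_definition ext_const :: "'r::comm_ring_1 \<Rightarrow> 'r exterior" is
  "\<lambda>r S. if S = {} then r else 0"
  by (auto intro: finite_subset[of _ "{{}}"] split: if_splits)

lift_definition ext_gen :: "nat \<Rightarrow> 'r::comm_ring_1 exterior" is
  "\<lambda>j S. if S = {j} then 1 else 0"
  by (auto split: if_splits)

lemma ecoeff_const_mult: "ecoeff (ext_const r * f) S = r * ecoeff f S"
  by (cases "finite S") (simp_all add: ecoeff_mult_scalar_left ext_const.rep_eq ecoeff_infinite)

lemma ext_const_0 [simp]: "ext_const 0 = 0"
  by transfer auto

lemma ext_const_1 [simp]: "ext_const 1 = 1"
  by transfer auto

lemma ext_const_add [simp]: "ext_const (a + b) = ext_const a + ext_const b"
  by transfer auto

lemma ext_const_uminus [simp]: "ext_const (- a) = - ext_const a"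
  by transfer auto

lemma ext_const_mult [simp]: "ext_const (a * b) = ext_const a * ext_const b"
  by (rule exterior_eqI) (simp add: ecoeff_const_mult ext_const.rep_eq)

lemma ext_const_power [simp]: "ext_const (a ^ k) = ext_const a ^ k"
  by (induction k) simp_all

lemma ext_gen_square: "ext_gen j * ext_gen j = 0"
  by (rule exterior_eqI)
    (auto simp: times_exterior.rep_eq ext_gen.rep_eq zero_exterior.rep_eq intro!: sum.neutral)


section \<open>The algebra $P_n = E(x_1, \dots, x_n) \otimes \mathbb{F}_p[y_1, \dots, y_n]$\<close>

text \<open>
  \<open>'p mod_ring\<close> is $\mathbb{F}_p$ for the prime \<open>p = CARD('p)\<close>. \<open>'p ypoly\<close> is
  $\mathbb{F}_p[y_0, y_1, \dots]$, a polynomial being the finitely supported map from exponent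
  vectors to coefficients. $E(x_0, x_1, \dots) \otimes \mathbb{F}_p[y_0, y_1, \dots]$ is the
  exterior algebra over \<open>'p ypoly\<close>, and $P_n$ is cut out as a subset of it.
\<close>

type_synonym 'p ypoly = "(nat \<Rightarrow>\<^sub>0 nat) \<Rightarrow>\<^sub>0 'p mod_ring"

type_synonym 'p xyalg = "'p ypoly exterior"

definition yvar :: "nat \<Rightarrow> 'p::prime_card ypoly" where
  "yvar j = Poly_Mapping.single (Poly_Mapping.single j 1) 1"

definition yconst :: "'p mod_ring \<Rightarrow> 'p::prime_card ypoly" where
  "yconst c = Poly_Mapping.single 0 c"

abbreviation incl :: "'p::prime_card ypoly \<Rightarrow> 'p xyalg" where
  "incl \<equiv> ext_const"

definition Y :: "nat \<Rightarrow> 'p::prime_card ypoly set" where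
  "Y n = {f. \<forall>\<alpha>\<in>Poly_Mapping.keys f. Poly_Mapping.keys \<alpha> \<subseteq> {1..n}}"

definition P :: "nat \<Rightarrow> 'p::prime_card xyalg set" where
  "P n = {f. \<forall>S. ecoeff f S \<noteq> 0 \<longrightarrow> S \<subseteq> {1..n} \<and> ecoeff f S \<in> Y n}"


section \<open>The action of $\mathrm{St}^{\Delta_i}$ on $P_n$\<close>

text \<open>
  $\mathrm{St}^{\Delta_i}$ is the Milnor basis element of the mod \<open>p\<close> Steenrod algebra dual to
  $\xi_i$. It is primitive, so by the Cartan formula it acts on $P_n$ as the
  $\mathbb{F}_p$-linear derivation with the values below on generators. Its degree $2(p^i - 1)$
  is even, so the Leibniz rule carries no sign. \<open>\<rightarrow>\<^sub>E\<close> fixes the irrelevant values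
  outside \<open>P n\<close>, which makes the derivation unique as a function.
\<close>

definition is_St :: "nat \<Rightarrow> nat \<Rightarrow> ('p::prime_card xyalg \<Rightarrow> 'p xyalg) \<Rightarrow> bool" where
  "is_St n i D \<longleftrightarrow>
     D \<in> P n \<rightarrow>\<^sub>E P n \<and>
     (\<forall>f\<in>P n. \<forall>g\<in>P n. D (f + g) = D f + D g) \<and>
     (\<forall>c. \<forall>f\<in>P n. D (incl (yconst c) * f) = incl (yconst c) * D f) \<and>
     (\<forall>f\<in>P n. \<forall>g\<in>P n. D (f * g) = D f * g + f * D g) \<and>
     (\<forall>j\<in>{1..n}. D (ext_gen j) = 0 \<and> D (incl (yvar j)) = incl (yvar j) ^ (CARD('p) ^ i))"

definition St :: "nat \<Rightarrow> nat \<Rightarrow> 'p::prime_card xyalg \<Rightarrow> 'p xyalg" where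
  "St n i = (THE D. is_St n i D)"

subsection \<open>Existence and uniqueness of the derivation\<close>

lemma Y_0: "0 \<in> Y n" and Y_1: "1 \<in> Y n" and Y_const: "yconst c \<in> Y n"
  by (auto simp: Y_def yconst_def)

lemma Y_add: "f \<in> Y n \<Longrightarrow> g \<in> Y n \<Longrightarrow> f + g \<in> Y n"
  unfolding Y_def using keys_add[of f g] by blast

lemma Y_uminus: "f \<in> Y n \<Longrightarrow> - f \<in> Y n"
  by (simp add: Y_def in_keys_iff)

lemma keys_nat_add: "Poly_Mapping.keys (\<alpha> + \<beta>) = Poly_Mapping.keys \<alpha> \<union> Poly_Mapping.keys \<beta>"
  for \<alpha> \<beta> :: "nat \<Rightarrow>\<^sub>0 nat"
  by (auto simp: in_keys_iff lookup_add)

lemma Y_mult: "f \<in> Y n \<Longrightarrow> g \<in> Y n \<Longrightarrow> f * g \<in> Y n"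
  unfolding Y_def using keys_mult[of f g] by (force simp: keys_nat_add)

lemma Y_power: "f \<in> Y n \<Longrightarrow> f ^ k \<in> Y n"
  by (induction k) (simp_all add: Y_1 Y_mult)

lemma Y_sum: "(\<And>a. a \<in> A \<Longrightarrow> f a \<in> Y n) \<Longrightarrow> sum f A \<in> Y n"
  by (induction A rule: infinite_finite_induct) (simp_all add: Y_0 Y_add)

lemma Y_yvar: "j \<in> {1..n} \<Longrightarrow> yvar j \<in> Y n"
  by (auto simp: Y_def yvar_def)

lemma Y_shuffle_sign: "shuffle_sign S T \<in> Y n"
  unfolding shuffle_sign_def by (intro Y_power Y_uminus Y_1)

lemma P_0: "0 \<in> P n"
  by (simp add: P_def zero_exterior.rep_eq)

lemma P_incl: "f \<in> Y n \<Longrightarrow> incl f \<in> P n"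
  by (auto simp: P_def ext_const.rep_eq)

lemma P_1: "1 \<in> P n"
  using P_incl[OF Y_1] by simp

lemma P_ext_gen: "j \<in> {1..n} \<Longrightarrow> ext_gen j \<in> P n"
  by (auto simp: P_def ext_gen.rep_eq Y_1)

lemma P_coeff: "f \<in> P n \<Longrightarrow> ecoeff f S \<in> Y n"
  by (cases "ecoeff f S = 0") (auto simp: P_def Y_0)

lemma P_supp: "f \<in> P n \<Longrightarrow> ecoeff f S \<noteq> 0 \<Longrightarrow> S \<subseteq> {1..n}"
  by (auto simp: P_def)

lemma P_add:
  assumes "f \<in> P n" "g \<in> P n" shows "f + g \<in> P n"
  unfolding P_def
proof clarify
  fix S assume "ecoeff (f + g) S \<noteq> 0"
  then have "ecoeff f S \<noteq> 0 \<or> ecoeff g S \<noteq> 0" by (auto simp: plus_exterior.rep_eq)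
  then show "S \<subseteq> {1..n} \<and> ecoeff (f + g) S \<in> Y n"
    using P_supp[OF assms(1)] P_supp[OF assms(2)] Y_add[OF P_coeff[OF assms(1)] P_coeff[OF assms(2)]]
    unfolding plus_exterior.rep_eq by blast
qed

lemma P_mult:
  assumes "f \<in> P n" "g \<in> P n" shows "f * g \<in> P n"
  unfolding P_def
proof clarify
  fix U assume "ecoeff (f * g) U \<noteq> 0"
  then obtain S where "S \<subseteq> U" "ecoeff f S \<noteq> 0" "ecoeff g (U - S) \<noteq> 0"
    unfolding times_exterior.rep_eq
    by (metis (no_types, lifting) PowD mult_not_zero sum.not_neutral_contains_not_neutral)
  then have "U \<subseteq> {1..n}" using P_supp[OF assms(1)] P_supp[OF assms(2)] by blast
  moreover have "ecoeff (f * g) U \<in> Y n"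
    using assms unfolding times_exterior.rep_eq
    by (intro Y_sum Y_mult Y_shuffle_sign P_coeff)
  ultimately show "U \<subseteq> {1..n} \<and> ecoeff (f * g) U \<in> Y n" by blast
qed

lemma P_sum: "(\<And>a. a \<in> A \<Longrightarrow> f a \<in> P n) \<Longrightarrow> sum f A \<in> P n"
  by (induction A rule: infinite_finite_induct) (simp_all add: P_0 P_add)

lift_definition ext_mono :: "nat set \<Rightarrow> 'r::comm_ring_1 exterior" is
  "\<lambda>T S. if S = T \<and> finite S then 1 else 0"
  by auto

lemma ext_mono_empty: "ext_mono {} = 1"
  by transfer auto

lemma ext_mono_insert:
  assumes "finite S" "\<And>s. s \<in> S \<Longrightarrow> s < m"
  shows "ext_mono (insert m S) = (ext_mono S * ext_gen m :: 'r::comm_ring_1 exterior)"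
proof (rule exterior_eqI)
  fix U :: "nat set" assume U: "finite U"
  have m: "m \<notin> S" using assms by blast
  have sgn: "shuffle_sign S {m} = (1::'r)"
  proof -
    have "{(s, t). s \<in> S \<and> t \<in> {m} \<and> t < s} = {}"
      using assms by (auto dest: less_asym)
    then show ?thesis unfolding shuffle_sign_def by (simp only: card.empty power_0)
  qed
  show "ecoeff (ext_mono (insert m S)) U = ecoeff (ext_mono S * ext_gen m :: 'r exterior) U"
  proof (cases "U = insert m S")
    case True
    have "(\<Sum>A\<in>Pow U. shuffle_sign A (U - A) * ecoeff (ext_mono S) A * ecoeff (ext_gen m) (U - A))
      = (\<Sum>A\<in>{S}. shuffle_sign A (U - A) * ecoeff (ext_mono S) A * ecoeff (ext_gen m) (U - A) :: 'r)"
      by (rule sum.mono_neutral_right) (use U True in \<open>auto simp: ext_mono.rep_eq\<close>)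
    then show ?thesis using True m sgn assms(1)
      by (simp add: times_exterior.rep_eq ext_mono.rep_eq ext_gen.rep_eq insert_Diff_if)
  next
    case False
    have "(\<Sum>A\<in>Pow U. shuffle_sign A (U - A) * ecoeff (ext_mono S) A * ecoeff (ext_gen m) (U - A)) = (0::'r)"
      by (rule sum.neutral) (use False in \<open>auto simp: ext_mono.rep_eq ext_gen.rep_eq\<close>)
    then show ?thesis using False by (simp add: times_exterior.rep_eq ext_mono.rep_eq)
  qed
qed

lemma ecoeff_sum: "ecoeff (sum f A) S = (\<Sum>a\<in>A. ecoeff (f a) S)"
  by (induction A rule: infinite_finite_induct)
    (simp_all add: zero_exterior.rep_eq plus_exterior.rep_eq)

lemma exterior_expand:
  "f = (\<Sum>S | ecoeff f S \<noteq> 0. ext_const (ecoeff f S) * ext_mono S)"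
  for f :: "'r::comm_ring_1 exterior"
proof (rule exterior_eqI)
  fix T :: "nat set" assume T: "finite T"
  have "(\<Sum>S | ecoeff f S \<noteq> 0. ecoeff f S * (if T = S \<and> finite T then 1 else 0)) =
     (\<Sum>S | ecoeff f S \<noteq> 0. if T = S then ecoeff f S else 0)"
    by (rule sum.cong) (use T in auto)
  also have "\<dots> = ecoeff f T" by (simp add: ecoeff_finite)
  finally show "ecoeff f T = ecoeff (\<Sum>S | ecoeff f S \<noteq> 0. ext_const (ecoeff f S) * ext_mono S) T"
    by (simp add: ecoeff_sum ecoeff_const_mult ext_mono.rep_eq)
qed

lemma ypoly_expand:
  "f = (\<Sum>\<alpha>\<in>Poly_Mapping.keys f. Poly_Mapping.single \<alpha> (Poly_Mapping.lookup f \<alpha>))"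
  by (rule poly_mapping_eqI) (simp add: lookup_sum lookup_single when_def in_keys_iff)

lemma ymono_expand:
  "Poly_Mapping.single \<alpha> c = yconst c * (\<Prod>j\<in>Poly_Mapping.keys \<alpha>. yvar j ^ Poly_Mapping.lookup \<alpha> j)"
proof -
  have pow: "yvar j ^ k = (Poly_Mapping.single (Poly_Mapping.single j k) 1 :: 'a ypoly)" for j k
    by (induction k) (simp_all add: yvar_def mult_single flip: single_add)
  have "(\<Prod>j\<in>A. yvar j ^ Poly_Mapping.lookup \<alpha> j) =
     (Poly_Mapping.single (\<Sum>j\<in>A. Poly_Mapping.single j (Poly_Mapping.lookup \<alpha> j)) 1 :: 'a ypoly)"
    if "finite A" for A
    using that by (induction A) (simp_all add: pow mult_single)
  from this[of "Poly_Mapping.keys \<alpha>"]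
  have "(\<Prod>j\<in>Poly_Mapping.keys \<alpha>. yvar j ^ Poly_Mapping.lookup \<alpha> j) =
      (Poly_Mapping.single \<alpha> 1 :: 'a ypoly)"
    by (simp flip: ypoly_expand)
  then show ?thesis by (simp add: yconst_def mult_single)
qed

lemma is_St_unique:
  assumes D: "is_St n i D" and E: "is_St n i E"
  shows "D = E"
proof -
  note Dd = D[unfolded is_St_def] and Ee = E[unfolded is_St_def]
  let ?C = "{f \<in> P n. D f = E f}"
  have mult: "f * g \<in> ?C" if "f \<in> ?C" "g \<in> ?C" for f g
    using that Dd Ee by (simp add: P_mult)
  have add: "f + g \<in> ?C" if "f \<in> ?C" "g \<in> ?C" for f g
    using that Dd Ee by (simp add: P_add)
  have one0: "F 1 = 0" if "is_St n i F" for F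
  proof -
    have "F (1 * 1) = F 1 * 1 + 1 * F 1" using that P_1[of n] unfolding is_St_def by blast
    then show ?thesis by simp
  qed
  have one: "1 \<in> ?C" using one0[OF D] one0[OF E] by (simp add: P_1)
  have smult: "incl (yconst c) * f \<in> ?C" if "f \<in> ?C" for c f
  proof -
    have "incl (yconst c) * f \<in> P n" using that by (simp add: P_mult P_incl Y_const)
    moreover have "D (incl (yconst c) * f) = incl (yconst c) * D f"
      "E (incl (yconst c) * f) = incl (yconst c) * E f"
      using that Dd Ee by blast+
    ultimately show ?thesis using that by (simp del: ext_const_mult)
  qed
  have zero: "0 \<in> ?C" using smult[OF one, of 0] by (simp add: yconst_def)
  have sum: "sum f A \<in> ?C" if "\<And>a. a \<in> A \<Longrightarrow> f a \<in> ?C" for f and A :: "'b set"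
    using that by (induction A rule: infinite_finite_induct) (use zero add in simp_all)
  have gen: "ext_gen j \<in> ?C" "incl (yvar j) \<in> ?C" if "j \<in> {1..n}" for j
    using that Dd Ee by (simp_all add: P_ext_gen P_incl Y_yvar)
  have pow: "f ^ k \<in> ?C" if "f \<in> ?C" for f k
    by (induction k) (use that one mult in simp_all)
  have prod: "incl (\<Prod>j\<in>A. yvar j ^ k j) \<in> ?C" if "A \<subseteq> {1..n}" for A k
  proof -
    have "finite A" using that finite_subset by blast
    then show ?thesis using that
    proof (induction A)
      case (insert a A)
      have "incl (yvar a) ^ k a * incl (\<Prod>j\<in>A. yvar j ^ k j) \<in> ?C"
        by (rule mult[OF pow]) (use insert gen(2) in simp_all)
      then show ?case using insert by simp
    qed (use one in simp)
  qed
  have mono: "ext_mono S \<in> ?C" if "S \<subseteq> {1..n}" for S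
  proof -
    have "finite S" using that finite_subset by blast
    then show ?thesis using that
    proof (induction S rule: finite_linorder_max_induct)
      case (insert b A)
      then show ?case using mult[OF _ gen(1), of "ext_mono A" b] by (simp add: ext_mono_insert)
    qed (use one in \<open>simp add: ext_mono_empty\<close>)
  qed
  have incl_sum: "incl (sum f A) = (\<Sum>a\<in>A. incl (f a))" for f and A :: "(nat \<Rightarrow>\<^sub>0 nat) set"
    by (induction A rule: infinite_finite_induct) simp_all
  have inclY: "incl f \<in> ?C" if "f \<in> Y n" for f
  proof -
    have "incl (Poly_Mapping.single \<alpha> (Poly_Mapping.lookup f \<alpha>)) \<in> ?C"
      if "\<alpha> \<in> Poly_Mapping.keys f" for \<alpha>
      unfolding ymono_expand ext_const_mult
      by (rule smult, rule prod) (use that \<open>f \<in> Y n\<close> in \<open>auto simp: Y_def\<close>)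
    then have "(\<Sum>\<alpha>\<in>Poly_Mapping.keys f. incl (Poly_Mapping.single \<alpha> (Poly_Mapping.lookup f \<alpha>))) \<in> ?C"
      by (rule sum)
    then show ?thesis by (simp only: flip: incl_sum ypoly_expand)
  qed
  have all: "f \<in> ?C" if "f \<in> P n" for f
    by (subst exterior_expand, rule sum, rule mult, rule inclY[OF P_coeff[OF that]], rule mono)
      (use P_supp[OF that] in simp)
  show ?thesis
  proof
    fix f
    show "D f = E f"
    proof (cases "f \<in> P n")
      case True
      then show ?thesis using all by blast
    next
      case False
      then show ?thesis using Dd Ee by (metis PiE_arb)
    qed
  qed
qed

text \<open>The derivation $\sum_j y_j^q\, \partial/\partial y_j$ of the polynomial ring.\<close>

definition dterm :: "nat \<Rightarrow> (nat \<Rightarrow>\<^sub>0 nat) \<Rightarrow> nat \<Rightarrow> 'p::prime_card ypoly" where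
  "dterm q \<alpha> j = Poly_Mapping.single (\<alpha> - Poly_Mapping.single j 1 + Poly_Mapping.single j q)
     (of_nat (Poly_Mapping.lookup \<alpha> j))"

definition dmono :: "nat \<Rightarrow> (nat \<Rightarrow>\<^sub>0 nat) \<Rightarrow> 'p::prime_card ypoly" where
  "dmono q \<alpha> = (\<Sum>j\<in>Poly_Mapping.keys \<alpha>. dterm q \<alpha> j)"

definition dpoly :: "nat \<Rightarrow> 'p::prime_card ypoly \<Rightarrow> 'p ypoly" where
  "dpoly q f = (\<Sum>\<alpha>\<in>Poly_Mapping.keys f. yconst (Poly_Mapping.lookup f \<alpha>) * dmono q \<alpha>)"

lemma dmono_superset:
  assumes "finite J" "Poly_Mapping.keys \<alpha> \<subseteq> J"
  shows "dmono q \<alpha> = (\<Sum>j\<in>J. dterm q \<alpha> j)"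
  unfolding dmono_def
  by (rule sum.mono_neutral_left) (use assms in \<open>auto simp: dterm_def in_keys_iff\<close>)

lemma dterm_add:
  "dterm q (\<alpha> + \<beta>) j = dterm q \<alpha> j * Poly_Mapping.single \<beta> 1 + Poly_Mapping.single \<alpha> 1 * dterm q \<beta> j"
proof -
  let ?e = "Poly_Mapping.single j (1::nat)" and ?q = "Poly_Mapping.single j q"
  have 1: "\<alpha> + \<beta> - ?e + ?q = \<alpha> - ?e + ?q + \<beta>" if "Poly_Mapping.lookup \<alpha> j \<noteq> 0"
    by (rule poly_mapping_eqI) (use that in \<open>auto simp: lookup_add lookup_minus lookup_single when_def\<close>)
  have 2: "\<alpha> + \<beta> - ?e + ?q = \<alpha> + (\<beta> - ?e + ?q)" if "Poly_Mapping.lookup \<beta> j \<noteq> 0"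
    by (rule poly_mapping_eqI) (use that in \<open>auto simp: lookup_add lookup_minus lookup_single when_def\<close>)
  show ?thesis
    using 1 2 by (cases "Poly_Mapping.lookup \<alpha> j = 0"; cases "Poly_Mapping.lookup \<beta> j = 0")
      (simp_all add: dterm_def mult_single lookup_add flip: single_add)
qed

lemma dmono_add:
  "(dmono q (\<alpha> + \<beta>) :: 'p::prime_card ypoly) = dmono q \<alpha> * Poly_Mapping.single \<beta> 1 + Poly_Mapping.single \<alpha> 1 * dmono q \<beta>"
proof -
  let ?J = "Poly_Mapping.keys \<alpha> \<union> Poly_Mapping.keys \<beta>"
  have *: "(dmono q \<gamma> :: 'p ypoly) = (\<Sum>j\<in>?J. dterm q \<gamma> j)"
    if "Poly_Mapping.keys \<gamma> \<subseteq> ?J" for \<gamma>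
    by (rule dmono_superset) (use that in auto)
  have "Poly_Mapping.keys (\<alpha> + \<beta>) \<subseteq> ?J" by (simp add: keys_nat_add)
  from *[OF this] *[of \<alpha>] *[of \<beta>] show ?thesis
    by (simp add: dterm_add sum.distrib sum_distrib_left sum_distrib_right)
qed

lemma yconst_simps: "yconst 0 = 0" "yconst (a + b) = yconst a + yconst b"
    "yconst (a * b) = yconst a * yconst b"
  by (simp_all add: yconst_def single_add mult_single)

lemma dpoly_add: "dpoly q (f + g) = dpoly q f + dpoly q g"
  for f g :: "'p::prime_card ypoly"
proof -
  let ?K = "Poly_Mapping.keys f \<union> Poly_Mapping.keys g"
  have *: "dpoly q h = (\<Sum>\<alpha>\<in>?K. yconst (Poly_Mapping.lookup h \<alpha>) * dmono q \<alpha>)"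
    if "Poly_Mapping.keys h \<subseteq> ?K" for h :: "'p ypoly"
    unfolding dpoly_def
    by (rule sum.mono_neutral_left) (use that in \<open>auto simp: in_keys_iff yconst_simps\<close>)
  from *[OF keys_add] *[of f] *[of g] show ?thesis
    by (simp add: lookup_add yconst_simps distrib_right sum.distrib)
qed

lemma dpoly_0: "dpoly q 0 = 0"
  by (simp add: dpoly_def)

lemma dpoly_sum: "dpoly q (sum f A) = (\<Sum>a\<in>A. dpoly q (f a))"
  by (induction A rule: infinite_finite_induct) (simp_all add: dpoly_0 dpoly_add)

lemma dpoly_uminus: "dpoly q (- f) = - dpoly q f"
  using dpoly_add[of q f "- f"] by (simp add: dpoly_0 eq_neg_iff_add_eq_0 add.commute)

lemma dpoly_single: "dpoly q (Poly_Mapping.single \<alpha> c) = yconst c * dmono q \<alpha>"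
  by (cases "c = 0") (simp_all add: dpoly_def yconst_simps)

lemma dpoly_mult: "dpoly q (f * g) = dpoly q f * g + f * dpoly q g"
proof -
  have s: "Poly_Mapping.single \<alpha> c = yconst c * Poly_Mapping.single \<alpha> 1" for \<alpha> and c :: "'a mod_ring"
    by (simp add: yconst_def mult_single)
  have m: "dpoly q (Poly_Mapping.single \<alpha> a * Poly_Mapping.single \<beta> b) =
     dpoly q (Poly_Mapping.single \<alpha> a) * Poly_Mapping.single \<beta> b
     + Poly_Mapping.single \<alpha> a * dpoly q (Poly_Mapping.single \<beta> b)"
    for \<alpha> \<beta> and a b :: "'a mod_ring"
    unfolding mult_single dpoly_single dmono_add
    by (subst (4) s, subst (3) s) (simp add: yconst_simps algebra_simps)
  have "dpoly q (sum F A * sum G B) = dpoly q (sum F A) * sum G B + sum F A * dpoly q (sum G B)"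
    if "\<And>\<alpha> \<beta>. dpoly q (F \<alpha> * G \<beta>) = dpoly q (F \<alpha>) * G \<beta> + F \<alpha> * dpoly q (G \<beta>)"
    for F G :: "(nat \<Rightarrow>\<^sub>0 nat) \<Rightarrow> 'a ypoly" and A B
    by (simp add: sum_product dpoly_sum that sum.distrib)
  from this[of "\<lambda>\<alpha>. Poly_Mapping.single \<alpha> (Poly_Mapping.lookup f \<alpha>)"
      "\<lambda>\<alpha>. Poly_Mapping.single \<alpha> (Poly_Mapping.lookup g \<alpha>)"
      "Poly_Mapping.keys f" "Poly_Mapping.keys g", OF m]
  show ?thesis by (simp flip: ypoly_expand)
qed

lemma dpoly_yconst: "dpoly q (yconst c) = 0"
  by (simp add: yconst_def dpoly_single) (simp add: dmono_def)

lemma dpoly_yvar: "dpoly q (yvar j) = yvar j ^ q"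
proof -
  have "yvar j ^ k = (Poly_Mapping.single (Poly_Mapping.single j k) 1 :: 'a ypoly)" for k
    by (induction k) (simp_all add: yvar_def mult_single flip: single_add)
  then show ?thesis
    by (simp add: yvar_def dpoly_single dmono_def dterm_def yconst_def mult_single)
qed

lemma dpoly_Y: "f \<in> Y n \<Longrightarrow> dpoly q f \<in> Y n"
  unfolding dpoly_def dmono_def
proof (intro Y_sum Y_mult Y_const)
  fix \<alpha> j assume "f \<in> Y n" "\<alpha> \<in> Poly_Mapping.keys f" "j \<in> Poly_Mapping.keys \<alpha>"
  then have *: "Poly_Mapping.keys \<alpha> \<subseteq> {1..n}" "j \<in> {1..n}" unfolding Y_def by blast+
  have "Poly_Mapping.keys (\<alpha> - Poly_Mapping.single j 1) \<subseteq> Poly_Mapping.keys \<alpha>"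
    by (auto simp: in_keys_iff lookup_minus)
  then show "dterm q \<alpha> j \<in> Y n"
    using * by (auto simp: Y_def dterm_def keys_nat_add split: if_splits)
qed

lift_definition dext :: "nat \<Rightarrow> 'p::prime_card xyalg \<Rightarrow> 'p xyalg" is
  "\<lambda>q f S. dpoly q (f S)"
proof -
  fix q and f :: "nat set \<Rightarrow> 'a::prime_card ypoly"
  assume a: "finite {S. f S \<noteq> 0} \<and> (\<forall>S. f S \<noteq> 0 \<longrightarrow> finite S)"
  have "{S. dpoly q (f S) \<noteq> 0} \<subseteq> {S. f S \<noteq> 0}" by (auto simp: dpoly_0)
  then show "finite {S. dpoly q (f S) \<noteq> 0} \<and> (\<forall>S. dpoly q (f S) \<noteq> 0 \<longrightarrow> finite S)"
    using a finite_subset by blast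
qed

lemma dext_add: "dext q (f + g) = dext q f + dext q g"
  by transfer (simp add: dpoly_add)

lemma dpoly_1: "dpoly q 1 = 0"
  using dpoly_yconst[of q 1] by (simp add: yconst_def)

lemma dpoly_shuffle_sign: "dpoly q (shuffle_sign S T) = 0"
proof -
  have "dpoly q ((- 1) ^ k :: 'a ypoly) = 0" for k
    by (induction k) (simp_all add: dpoly_1 dpoly_uminus)
  then show ?thesis by (simp add: shuffle_sign_def)
qed

lemma dext_mult: "dext q (f * g) = dext q f * g + f * dext q g"
  by (rule exterior_eqI)
    (simp add: dext.rep_eq times_exterior.rep_eq plus_exterior.rep_eq dpoly_sum mult.assoc
      dpoly_shuffle_sign dpoly_mult distrib_left sum.distrib)

lemma dext_incl: "dext q (incl f) = incl (dpoly q f)"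
  by transfer (auto simp: dpoly_0)

lemma dext_gen: "dext q (ext_gen j) = 0"
  by (rule exterior_eqI)
    (simp add: dext.rep_eq ext_gen.rep_eq zero_exterior.rep_eq dpoly_0 dpoly_1)

lemma dext_P:
  assumes "f \<in> P n" shows "dext q f \<in> P n"
  unfolding P_def
proof clarify
  fix S assume "ecoeff (dext q f) S \<noteq> 0"
  then have "ecoeff f S \<noteq> 0" by (auto simp: dext.rep_eq dpoly_0)
  then show "S \<subseteq> {1..n} \<and> ecoeff (dext q f) S \<in> Y n"
    using P_supp[OF assms] P_coeff[OF assms] by (simp add: dext.rep_eq dpoly_Y)
qed

lemma is_St_dext: "is_St n i (restrict (dext (CARD('p) ^ i)) (P n :: 'p::prime_card xyalg set))"
proof -
  let ?D = "restrict (dext (CARD('p) ^ i)) (P n :: 'p xyalg set)"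
  have D: "?D f = dext (CARD('p) ^ i) f" if "f \<in> P n" for f
    using that by simp
  have lin: "?D (incl (yconst c) * f) = incl (yconst c) * ?D f" if "f \<in> P n" for c f
    unfolding D[OF that] D[OF P_mult[OF P_incl[OF Y_const] that]]
    by (simp only: dext_mult dext_incl dpoly_yconst ext_const_0 mult_zero_left add_0_left)
  have gens: "?D (ext_gen j) = 0" "?D (incl (yvar j)) = incl (yvar j) ^ (CARD('p) ^ i)"
    if "j \<in> {1..n}" for j
    unfolding D[OF P_ext_gen[OF that]] D[OF P_incl[OF Y_yvar[OF that]]]
    by (simp_all only: dext_gen dext_incl dpoly_yvar ext_const_power)
  have ring: "?D (f + g) = ?D f + ?D g" "?D (f * g) = ?D f * g + f * ?D g"
    if "f \<in> P n" "g \<in> P n" for f g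
    unfolding D[OF that(1)] D[OF that(2)] D[OF P_add[OF that]] D[OF P_mult[OF that]]
    by (rule dext_add dext_mult)+
  have "?D \<in> P n \<rightarrow>\<^sub>E P n" unfolding restrict_PiE_iff by (intro ballI dext_P)
  then show ?thesis
    unfolding is_St_def
    by (intro conjI ballI allI) (assumption | rule lin gens ring)+
qed

lemma St_ex1: "\<exists>!D. is_St n i D"
  using is_St_dext is_St_unique by blast

lemma St_is_St: "is_St n i (St n i)"
  unfolding St_def by (rule theI'[OF St_ex1])


section \<open>Determinants and the Mui invariants\<close>

text \<open>$[e_1, \dots, e_m]$ is the determinant of $(y_a^{p^{e_b}})$, $1 \le a, b \le m$;
  matrix indices start at 0.\<close>

definition bracket :: "nat list \<Rightarrow> 'p::prime_card ypoly" where
  "bracket es = det (mat (length es) (length es)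
     (\<lambda>(a, b). yvar (Suc a) ^ (CARD('p) ^ (es ! b))))"

definition L :: "nat \<Rightarrow> 'p::prime_card ypoly" where
  "L m = bracket [0..<m]"

lemma L_0: "L 0 = 1"
  by (simp add: L_def bracket_def det_dim_zero)

text \<open>
  The exact quotient $L_n / L_{n-1}$ in the polynomial ring, an integral domain. It exists by
  Moore's factorization of the determinants.
\<close>

definition V :: "nat \<Rightarrow> 'p::prime_card ypoly" where
  "V n = (THE v. v * L (n - 1) = L n)"

end

theory Submission
  imports Defs
begin

text \<open>
  Write $q = p^i$ and let $D = \sum_j y_j^q\, \partial/\partial y_j$, so that
  $\mathrm{St}^{\Delta_i}$ restricts to $D$ on polynomials in the \<open>y\<^sub>j\<close>. The key object is the
  additive polynomial
  $$f_m(x) = \prod_{v \in \langle y_1, \dots, y_m \rangle} (x - v) = \sum_{s \le m} c_{m,s}\, x^{p^s},$$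
  monic and zero at \<open>y\<^sub>1, \<dots>, y\<^sub>m\<close>. It is used through its coefficients \<open>c\<^sub>m\<^sub>,\<^sub>s\<close>, which the
  recursion $f_{m+1}(x) = f_m(x)^p - f_m(y_{m+1})^{p-1} f_m(x)$ produces.

  Both \<open>V\<^sub>n\<close> and its derivative come from one fact of linear algebra, \<open>bracket_relation\<close>: if a
  combination of the columns of \<open>[0, \<dots>, m-1, e]\<close> with coefficient \<open>c\<close> at the last column vanishes
  in the first \<open>m\<close> rows and has the value \<open>r\<close> in row \<open>m+1\<close>, then \<open>c [0, \<dots>, m-1, e] = r L\<^sub>m\<close>.

  \<^item> For \<open>e = m\<close>, the coefficients of \<open>f\<^sub>m\<close> give such a combination, with \<open>r = f\<^sub>m(y\<^sub>m\<^sub>+\<^sub>1)\<close> and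
    \<open>c = 1\<close>. Hence $L_{m+1} = f_m(y_{m+1}) L_m$, that is, $V_{m+1} = f_m(y_{m+1})$ (\<open>V_Suc\<close>),
    because \<open>L\<^sub>m\<close> is not zero (\<open>L_nonzero\<close>).

  \<^item> For \<open>e = i\<close>, apply \<open>D\<close> to $f_m(y_j)$. Since \<open>D\<close> kills \<open>p\<close>-th powers and \<open>c\<^sub>m\<^sub>,\<^sub>m = 1\<close>, the result is
    $\sum_{s < m} D(c_{m,s})\, y_j^{p^s} + c_{m,0}\, y_j^q$, which is zero for \<open>j \<le> m\<close> and
    $D(V_{m+1})$ for \<open>j = m+1\<close>. Hence $c_{m,0}\, [0, \dots, m-1, i] = D(V_{m+1})\, L_m$.

  The recursion shows $c_{m,0} = (-1)^m L_m^{p-1}$ (\<open>dickson_bottom\<close>), and cancelling \<open>L\<^sub>m\<close> leaves the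
  claim for \<open>n = m + 1\<close>.
\<close>

section \<open>Characteristic \<open>p\<close>\<close>

lemma of_nat_ypoly: "(of_nat k :: 'p::prime_card ypoly) = yconst (of_nat k)"
  by (induction k) (simp_all add: yconst_def single_add)

lemma CHAR_ypoly: "CHAR('p::prime_card ypoly) = CARD('p)"
proof (rule CHAR_eqI)
  show "of_nat CARD('p) = (0 :: 'p ypoly)"
    by (simp add: of_nat_ypoly yconst_def flip: semiring_char_mod_ring)
next
  fix k assume "of_nat k = (0 :: 'p ypoly)"
  then have "(of_nat k :: 'p mod_ring) = 0" unfolding of_nat_ypoly yconst_def
    by (metis lookup_single_eq lookup_zero)
  then show "CARD('p) dvd k" by (rule of_nat_0_mod_ring_dvd)
qed

lemma ypoly_power_card_add:
  "(f + g) ^ CARD('p) = f ^ CARD('p) + g ^ CARD('p)" for f g :: "'p::prime_card ypoly"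
  by (rule freshmans_dream) (simp_all add: CHAR_ypoly prime_card)

lemma ypoly_power_card_sum:
  "sum f A ^ CARD('p) = (\<Sum>a\<in>A. f a ^ CARD('p))" for f :: "'b \<Rightarrow> 'p::prime_card ypoly"
  by (rule freshmans_dream_sum) (simp_all add: CHAR_ypoly prime_card)

lemma dpoly_power: "dpoly q (f ^ k) = of_nat k * f ^ (k - 1) * dpoly q f"
proof (induction k)
  case (Suc k)
  then show ?case
    by (cases k) (simp_all add: dpoly_1 dpoly_mult algebra_simps)
qed (simp add: dpoly_1)

text \<open>
  The power rule puts the factor \<open>p\<^sup>s\<close> in front, which is zero in characteristic \<open>p\<close> unless
  \<open>s = 0\<close>. So only the linear term of an additive polynomial in \<open>y\<^sub>j\<close> contributes the
  derivative of \<open>y\<^sub>j\<close>.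
\<close>

lemma dpoly_frobenius_power:
  fixes f :: "'p::prime_card ypoly"
  shows "dpoly q (f ^ (CARD('p) ^ s)) = (if s = 0 then dpoly q f else 0)"
proof (cases "s = 0")
  case False
  then have "(of_nat (CARD('p) ^ s) :: 'p ypoly) = 0"
    using of_nat_CHAR[where 'a = "'p ypoly"] unfolding CHAR_ypoly by simp
  then show ?thesis using False by (simp only: dpoly_power) simp
qed simp


section \<open>Linear relations between the columns of a determinant\<close>

text \<open>
  This is Cramer's rule for the system \<open>A x = b\<close> with solution \<open>a\<close>: when the last column of \<open>A\<close> is
  replaced by \<open>b = A a\<close>, the determinant is multiplied by \<open>a m\<close>. Here \<open>b\<close> has at most one nonzero
  entry, the one at the bottom, so expansion along the new column has a single term.
\<close>

lemma det_column_relation: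
  fixes A :: "'a::comm_ring_1 mat"
  assumes A: "A \<in> carrier_mat (Suc m) (Suc m)"
    and zero: "\<And>i. i < m \<Longrightarrow> (\<Sum>j\<le>m. A $$ (i, j) * a j) = 0"
  shows "a m * det A = (\<Sum>j\<le>m. A $$ (m, j) * a j) * det (mat_delete A m m)"
proof -
  let ?v = "vec (Suc m) a"
  let ?B = "replace_col A (A *\<^sub>v ?v) m"
  have Av: "(A *\<^sub>v ?v) $ i = (\<Sum>j\<le>m. A $$ (i, j) * a j)" if "i < Suc m" for i
    using A that by (simp add: scalar_prod_def atLeast0LessThan lessThan_Suc_atMost)
  have B: "?B \<in> carrier_mat (Suc m) (Suc m)" using A by (simp add: replace_col_def)
  have entry: "?B $$ (i, m) = (if i = m then \<Sum>j\<le>m. A $$ (m, j) * a j else 0)"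
    if "i < Suc m" for i
    using A that Av[OF that] zero[of i] by (auto simp: replace_col_def)
  have del: "mat_delete ?B m m = mat_delete A m m"
    using A by (intro eq_matI) (auto simp: mat_delete_def replace_col_def)
  have "a m * det A = det ?B"
    using cramer_lemma_mat[OF A, of ?v m] by simp
  also have "\<dots> = (\<Sum>i<Suc m. ?B $$ (i, m) * cofactor ?B i m)"
    by (rule laplace_expansion_column[OF B]) simp
  also have "\<dots> = (\<Sum>i<Suc m. if i = m then (\<Sum>j\<le>m. A $$ (m, j) * a j) * cofactor ?B m m else 0)"
    by (rule sum.cong) (simp_all add: entry)
  also have "\<dots> = (\<Sum>j\<le>m. A $$ (m, j) * a j) * cofactor ?B m m"
    by simp
  finally show ?thesis by (simp add: cofactor_def del)
qed

text \<open>
  Column \<open>s\<close> of the bracket gets the coefficient \<open>a s\<close> and the last column gets \<open>c\<close>. The row of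
  \<open>y\<^sub>j\<close> then sums to the value at \<open>y\<^sub>j\<close> of one polynomial $\sum_s a_s x^{p^s} + c\, x^{p^e}$, so the
  hypothesis asks for a polynomial of this shape with the roots \<open>y\<^sub>1, \<dots>, y\<^sub>m\<close>.
\<close>

lemma bracket_relation:
  fixes a :: "nat \<Rightarrow> 'p::prime_card ypoly" and c :: "'p ypoly" and m :: nat
  defines "r e j \<equiv> (\<Sum>s<m. a s * yvar j ^ (CARD('p) ^ s)) + c * yvar j ^ (CARD('p) ^ e)"
  assumes zero: "\<And>j. j \<in> {1..m} \<Longrightarrow> r e j = 0"
  shows "c * bracket ([0..<m] @ [e]) = r e (Suc m) * L m"
proof -
  let ?es = "[0..<m] @ [e]" and ?b = "\<lambda>s. if s = m then c else a s"
  let ?A = "mat (Suc m) (Suc m) (\<lambda>(i, s). yvar (Suc i) ^ (CARD('p) ^ (?es ! s))) :: 'p ypoly mat"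
  have row: "(\<Sum>s\<le>m. ?A $$ (i, s) * ?b s) = r e (Suc i)" if "i < Suc m" for i
  proof -
    have "(\<Sum>s<m. ?A $$ (i, s) * ?b s) = (\<Sum>s<m. a s * yvar (Suc i) ^ (CARD('p) ^ s))"
      by (rule sum.cong) (use that in \<open>simp_all add: nth_append\<close>)
    moreover have "?A $$ (i, m) * ?b m = c * yvar (Suc i) ^ (CARD('p) ^ e)"
      using that by (simp add: nth_append)
    ultimately show ?thesis by (simp add: r_def flip: lessThan_Suc_atMost)
  qed
  have "mat_delete ?A m m = mat m m (\<lambda>(i, s). yvar (Suc i) ^ (CARD('p) ^ ([0..<m] ! s)))"
    by (intro eq_matI) (auto simp: mat_delete_def nth_append)
  then have L: "det (mat_delete ?A m m) = L m" by (simp add: L_def bracket_def)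
  have "?b m * det ?A = (\<Sum>s\<le>m. ?A $$ (m, s) * ?b s) * det (mat_delete ?A m m)"
  proof (rule det_column_relation)
    fix i assume "i < m"
    then show "(\<Sum>s\<le>m. ?A $$ (i, s) * ?b s) = 0"
      using row[of i] zero[of "Suc i"] by simp
  qed simp
  then show ?thesis using L row[of m] by (simp add: bracket_def)
qed


section \<open>The additive polynomials vanishing on \<open>y\<^sub>1, \<dots>, y\<^sub>m\<close>\<close>

text \<open>
  The coefficients of \<open>f\<^sub>m\<close>; up to sign they are the Dickson invariants of
  $GL_m(\mathbb{F}_p)$. With $w = f_m(y_{m+1})$, the sum in the second equation, the roots of \<open>f\<^sub>m\<^sub>+\<^sub>1\<close>
  are the points where \<open>f\<^sub>m\<close> takes a value \<open>k w\<close> with $k \in \mathbb{F}_p$, and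
  $\prod_k (z - k w) = z^p - w^{p-1} z$. Taking \<open>p\<close>-th powers of $\sum_s c_{m,s} x^{p^s}$ raises the
  coefficients to the power \<open>p\<close> and shifts their index by one.
\<close>

primrec dickson :: "nat \<Rightarrow> nat \<Rightarrow> 'p::prime_card ypoly" where
  "dickson 0 s = (if s = 0 then 1 else 0)"
| "dickson (Suc m) s = (case s of 0 \<Rightarrow> 0 | Suc t \<Rightarrow> dickson m t ^ CARD('p))
     - (\<Sum>t\<le>m. dickson m t * yvar (Suc m) ^ (CARD('p) ^ t)) ^ (CARD('p) - 1) * dickson m s"

definition additive_poly :: "nat \<Rightarrow> 'p::prime_card ypoly \<Rightarrow> 'p ypoly" where
  "additive_poly m x = (\<Sum>t\<le>m. dickson m t * x ^ (CARD('p) ^ t))"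

lemma card_gt_1: "1 < CARD('p::prime_card)"
  using prime_card[where 'a='p] prime_gt_1_nat by blast

lemma dickson_above: "m < s \<Longrightarrow> dickson m s = 0"
  using card_gt_1[where 'p='a]
  by (induction m arbitrary: s) (auto simp: power_0_left split: nat.split)

lemma dickson_top: "dickson m m = 1"
  by (induction m) (simp_all add: dickson_above)

lemma additive_poly_0: "additive_poly 0 x = x"
  by (simp add: additive_poly_def)

lemma additive_poly_Suc:
  fixes x :: "'p::prime_card ypoly"
  shows "additive_poly (Suc m) x = additive_poly m x ^ CARD('p)
    - additive_poly m (yvar (Suc m)) ^ (CARD('p) - 1) * additive_poly m x"
proof -
  let ?w = "additive_poly m (yvar (Suc m)) ^ (CARD('p) - 1) :: 'p ypoly"
  have rec: "dickson (Suc m) s = (case s of 0 \<Rightarrow> 0 | Suc t \<Rightarrow> dickson m t ^ CARD('p)) - ?w * dickson m s"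
    for s by (simp add: additive_poly_def)
  have "additive_poly (Suc m) x =
      (\<Sum>s\<le>Suc m. (case s of 0 \<Rightarrow> 0 | Suc t \<Rightarrow> dickson m t ^ CARD('p)) * x ^ (CARD('p) ^ s))
      - ?w * (\<Sum>s\<le>Suc m. dickson m s * x ^ (CARD('p) ^ s))"
    unfolding additive_poly_def[of "Suc m"] rec
    by (simp only: left_diff_distrib sum_subtractf sum_distrib_left mult.assoc)
  also have "(\<Sum>s\<le>Suc m. dickson m s * x ^ (CARD('p) ^ s)) = additive_poly m x"
    by (simp add: additive_poly_def dickson_above)
  also have "(\<Sum>s\<le>Suc m. (case s of 0 \<Rightarrow> 0 | Suc t \<Rightarrow> dickson m t ^ CARD('p)) * x ^ (CARD('p) ^ s))
      = (\<Sum>t\<le>m. (dickson m t * x ^ (CARD('p) ^ t)) ^ CARD('p))"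
    by (subst sum.atMost_Suc_shift) (simp add: power_mult_distrib mult.commute flip: power_mult)
  also have "\<dots> = additive_poly m x ^ CARD('p)"
    by (simp add: additive_poly_def ypoly_power_card_sum)
  finally show ?thesis .
qed

text \<open>
  The right-hand side of the recursion is $f_m(x)\,(f_m(x)^{p-1} - f_m(y_{m+1})^{p-1})$: the first
  factor keeps the old roots, the second one adds the root \<open>y\<^sub>m\<^sub>+\<^sub>1\<close>.
\<close>

lemma additive_poly_vanishes:
  "j \<in> {1..m} \<Longrightarrow> additive_poly m (yvar j :: 'p::prime_card ypoly) = 0"
proof (induction m)
  case (Suc m)
  let ?f = "additive_poly m (yvar j :: 'p ypoly)"
  show ?case
  proof (cases "j = Suc m")
    case True
    have "?f ^ CARD('p) = ?f ^ (CARD('p) - 1) * ?f"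
      using card_gt_1[where 'p='p] by (metis gr_implies_not0 not_gr_zero power_minus_mult)
    then show ?thesis using True by (simp add: additive_poly_Suc)
  next
    case False
    then have "?f = 0" using Suc by simp
    then show ?thesis using card_gt_1[where 'p='p] by (simp add: additive_poly_Suc power_0_left)
  qed
qed simp

lemma additive_poly_split:
  "additive_poly m (x :: 'p::prime_card ypoly)
    = (\<Sum>s<m. dickson m s * x ^ (CARD('p) ^ s)) + 1 * x ^ (CARD('p) ^ m)"
  by (simp add: additive_poly_def dickson_top flip: lessThan_Suc_atMost)

text \<open>
  The columns of \<open>L\<^sub>m\<^sub>+\<^sub>1\<close>, combined with the coefficients of \<open>f\<^sub>m\<close>, become
  $(0, \dots, 0, f_m(y_{m+1}))$.
\<close>

lemma L_Suc: "L (Suc m) = additive_poly m (yvar (Suc m)) * L m"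
proof -
  have "1 * bracket ([0..<m] @ [m])
      = ((\<Sum>s<m. dickson m s * yvar (Suc m) ^ (CARD('a) ^ s)) + 1 * yvar (Suc m) ^ (CARD('a) ^ m))
        * (L m :: 'a ypoly)"
    by (rule bracket_relation) (simp only: additive_poly_vanishes flip: additive_poly_split)
  then show ?thesis
    unfolding additive_poly_split[symmetric] by (simp add: L_def)
qed

text \<open>
  The \<open>p\<close>-th power in the recursion has no linear term, so each step multiplies the linear coefficient
  by $-f_m(y_{m+1})^{p-1} = -(L_{m+1}/L_m)^{p-1}$.
\<close>

lemma dickson_bottom:
  "dickson m 0 = (-1) ^ m * (L m :: 'p::prime_card ypoly) ^ (CARD('p) - 1)"
proof (induction m)
  case (Suc m)
  have "dickson (Suc m) 0 = - (additive_poly m (yvar (Suc m)) ^ (CARD('p) - 1) * dickson m 0 :: 'p ypoly)"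
    by (simp add: additive_poly_def)
  then show ?case by (simp add: Suc L_Suc power_mult_distrib)
qed (simp add: L_0)


section \<open>The determinants \<open>L\<^sub>m\<close> do not vanish\<close>

text \<open>
  The ideal generated by the \<open>y\<^sub>j\<close> with \<open>j \<noteq> k\<close>, that is, the polynomials that become zero when all
  variables other than \<open>y\<^sub>k\<close> are set to zero.
\<close>

definition off_axis :: "nat \<Rightarrow> 'p::prime_card ypoly set" where
  "off_axis k = {f. \<forall>\<alpha>\<in>Poly_Mapping.keys f. \<not> Poly_Mapping.keys \<alpha> \<subseteq> {k}}"

lemma off_axis_0: "0 \<in> off_axis k"
  by (simp add: off_axis_def)

lemma off_axis_add: "f \<in> off_axis k \<Longrightarrow> g \<in> off_axis k \<Longrightarrow> f + g \<in> off_axis k"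
  unfolding off_axis_def using keys_add[of f g] by blast

lemma off_axis_diff: "f \<in> off_axis k \<Longrightarrow> g \<in> off_axis k \<Longrightarrow> f - g \<in> off_axis k"
  unfolding off_axis_def using keys_diff[of f g] by blast

lemma off_axis_mult: "f \<in> off_axis k \<Longrightarrow> g * f \<in> off_axis k"
  unfolding off_axis_def using keys_mult[of g f] by (fastforce simp: keys_nat_add)

lemma off_axis_power: "f \<in> off_axis k \<Longrightarrow> 0 < n \<Longrightarrow> f ^ n \<in> off_axis k"
  by (cases n) (simp_all add: off_axis_mult mult.commute[of f])

lemma off_axis_sum: "(\<And>a. a \<in> A \<Longrightarrow> f a \<in> off_axis k) \<Longrightarrow> sum f A \<in> off_axis k"
  by (induction A rule: infinite_finite_induct) (simp_all add: off_axis_add off_axis_0)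

lemma off_axis_yvar: "j \<noteq> k \<Longrightarrow> yvar j \<in> off_axis k"
  by (simp add: off_axis_def yvar_def)

lemma yvar_power_notin_off_axis: "(yvar k :: 'p::prime_card ypoly) ^ n \<notin> off_axis k"
proof -
  have "yvar k ^ n = (Poly_Mapping.single (Poly_Mapping.single k n) 1 :: 'p ypoly)"
    by (induction n) (simp_all add: yvar_def mult_single flip: single_add)
  then show ?thesis by (simp add: off_axis_def)
qed

lemma additive_poly_off_axis: "x \<in> off_axis k \<Longrightarrow> additive_poly m x \<in> off_axis k"
  unfolding additive_poly_def
  using card_gt_1[where 'p='a] by (intro off_axis_sum off_axis_mult off_axis_power) auto

text \<open>
  For \<open>m < k\<close>, setting all variables other than \<open>y\<^sub>k\<close> to zero sends every root
  \<open>v\<close> of \<open>f\<^sub>m\<close> to zero, so only the leading power survives in $f_m(y_k)$.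
\<close>

lemma additive_poly_leading:
  "m < k \<Longrightarrow> additive_poly m (yvar k) - yvar k ^ (CARD('p) ^ m) \<in> (off_axis k :: 'p::prime_card ypoly set)"
proof (induction m)
  case (Suc m)
  let ?f = "additive_poly m (yvar k) :: 'p ypoly" and ?y = "yvar k ^ (CARD('p) ^ m) :: 'p ypoly"
  let ?w = "additive_poly m (yvar (Suc m)) :: 'p ypoly"
  have w: "?w \<in> off_axis k"
    using Suc.prems by (intro additive_poly_off_axis off_axis_yvar) simp
  have "?f ^ CARD('p) = ?y ^ CARD('p) + (?f - ?y) ^ CARD('p)"
    using ypoly_power_card_add[of ?y "?f - ?y"] by simp
  then have "additive_poly (Suc m) (yvar k) - yvar k ^ (CARD('p) ^ Suc m)
      = (?f - ?y) ^ CARD('p) - ?f * ?w ^ (CARD('p) - 1)"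
    by (simp add: additive_poly_Suc mult.commute flip: power_mult)
  moreover have "(?f - ?y) ^ CARD('p) \<in> off_axis k"
    by (rule off_axis_power) (use Suc card_gt_1[where 'p='p] in auto)
  moreover have "?f * ?w ^ (CARD('p) - 1) \<in> off_axis k"
    by (intro off_axis_mult off_axis_power w) (use card_gt_1[where 'p='p] in simp)
  ultimately show ?case using off_axis_diff by metis
qed (simp add: additive_poly_0 off_axis_def)

text \<open>
  By induction, as a product of nonzero factors: $f_m(y_{m+1})$ differs from a power of \<open>y\<^sub>m\<^sub>+\<^sub>1\<close> by an
  element of an ideal that contains no such power.
\<close>

lemma L_nonzero: "(L m :: 'p::prime_card ypoly) \<noteq> 0"
proof (induction m)
  case (Suc m)
  have "additive_poly m (yvar (Suc m)) \<noteq> (0 :: 'p ypoly)"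
  proof
    assume "additive_poly m (yvar (Suc m)) = (0 :: 'p ypoly)"
    then have "- (yvar (Suc m) ^ (CARD('p) ^ m)) \<in> (off_axis (Suc m) :: 'p ypoly set)"
      using additive_poly_leading[of m "Suc m", where 'p='p] by simp
    from off_axis_diff[OF off_axis_0 this] show False
      using yvar_power_notin_off_axis[where 'p='p] by simp
  qed
  then show ?case using Suc by (simp add: L_Suc)
qed (simp add: L_0)


section \<open>The invariant \<open>V\<^sub>n\<close> and its derivative\<close>

lemma V_Suc: "V (Suc m) = additive_poly m (yvar (Suc m))"
  unfolding V_def
proof (rule the_equality)
  fix v :: "'a ypoly" assume "v * L (Suc m - 1) = L (Suc m)"
  then show "v = additive_poly m (yvar (Suc m))" using L_nonzero[of m, where 'p='a] by (simp add: L_Suc)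
qed (simp add: L_Suc)

lemma dickson_Y: "m \<le> n \<Longrightarrow> dickson m s \<in> Y n"
proof (induction m arbitrary: s)
  case 0
  then show ?case by (simp add: Y_0 Y_1)
next
  case (Suc m)
  have diff: "f - g \<in> Y n" if "f \<in> Y n" "g \<in> Y n" for f g :: "'a ypoly"
    using Y_add[OF that(1) Y_uminus[OF that(2)]] by simp
  show ?case
    unfolding dickson.simps
    by (intro diff Y_mult Y_power Y_sum Y_yvar) (use Suc in \<open>auto simp: Y_0 Y_power split: nat.split\<close>)
qed

lemma V_Y: "V (Suc m) \<in> Y (Suc m)"
  unfolding V_Suc additive_poly_def
  by (intro Y_sum Y_mult Y_power Y_yvar dickson_Y) auto

text \<open>
  The top coefficient of \<open>f\<^sub>m\<close> is constant, so its derivative drops out and \<open>m\<close> derivatives of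
  coefficients remain. The result again has the shape to which \<open>bracket_relation\<close> applies, now
  with the last exponent \<open>i\<close>.
\<close>

lemma dpoly_additive_poly_yvar:
  "dpoly (CARD('p) ^ i) (additive_poly m (yvar j :: 'p::prime_card ypoly))
    = (\<Sum>s<m. dpoly (CARD('p) ^ i) (dickson m s) * yvar j ^ (CARD('p) ^ s))
      + dickson m 0 * yvar j ^ (CARD('p) ^ i)"
proof -
  let ?D = "dpoly (CARD('p) ^ i) :: 'p ypoly \<Rightarrow> 'p ypoly"
  have "?D (additive_poly m (yvar j))
      = (\<Sum>s\<le>m. ?D (dickson m s) * yvar j ^ (CARD('p) ^ s)
          + (if s = 0 then dickson m 0 * yvar j ^ (CARD('p) ^ i) else 0))"
    unfolding additive_poly_def dpoly_sum dpoly_mult dpoly_frobenius_power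
    by (rule sum.cong) (simp_all add: dpoly_yvar)
  also have "\<dots> = (\<Sum>s\<le>m. ?D (dickson m s) * yvar j ^ (CARD('p) ^ s))
      + dickson m 0 * yvar j ^ (CARD('p) ^ i)"
    by (simp add: sum.distrib)
  finally show ?thesis by (simp add: dickson_top dpoly_1 flip: lessThan_Suc_atMost)
qed

text \<open>
  The relation of columns holds because $f_m(y_j) = 0$ for \<open>j \<le> m\<close>, hence also its derivative. It
  gives $D(V_{m+1})\, L_m = (-1)^m L_m^{p-1}\, [0, \dots, m-1, i]$, where \<open>L\<^sub>m\<close> can be cancelled.
\<close>

lemma dpoly_V:
  "dpoly (CARD('p) ^ i) (V (Suc m) :: 'p::prime_card ypoly)
    = (-1) ^ m * bracket ([0..<m] @ [i]) * L m ^ (CARD('p) - 2)"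
proof -
  let ?D = "dpoly (CARD('p) ^ i) :: 'p ypoly \<Rightarrow> 'p ypoly"
  have "dickson m 0 * bracket ([0..<m] @ [i]) = ?D (additive_poly m (yvar (Suc m))) * L m"
    unfolding dpoly_additive_poly_yvar
    by (rule bracket_relation)
      (simp only: additive_poly_vanishes dpoly_0 flip: dpoly_additive_poly_yvar)
  moreover have "CARD('p) - 1 = Suc (CARD('p) - 2)" using card_gt_1[where 'p='p] by simp
  ultimately have "?D (V (Suc m)) * L m
      = ((-1) ^ m * bracket ([0..<m] @ [i]) * L m ^ (CARD('p) - 2)) * L m"
    by (auto simp: V_Suc dickson_bottom mult_ac)
  then show ?thesis using L_nonzero[of m, where 'p='p] mult_right_cancel by blast
qed

lemma St_incl:
  fixes f :: "'p::prime_card ypoly"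
  assumes "f \<in> Y n"
  shows "St n i (incl f) = incl (dpoly (CARD('p) ^ i) f)"
proof -
  have "St n i = restrict (dext (CARD('p) ^ i)) (P n :: 'p xyalg set)"
    by (rule is_St_unique[OF St_is_St is_St_dext])
  then show ?thesis using P_incl[OF assms] by (simp add: dext_incl)
qed

theorem theorem3p5:
  fixes i n :: nat
  assumes "odd CARD('p::prime_card)" and "i \<ge> 1" and "n \<ge> 1"
  shows "St n i (incl (V n :: 'p ypoly)) =
         incl ((-1) ^ (n - 1) * bracket ([0..<n - 1] @ [i]) * L (n - 1) ^ (CARD('p) - 2))"
proof -
  obtain m where n: "n = Suc m" using assms(3) by (cases n) auto
  show ?thesis unfolding n by (simp only: St_incl[OF V_Y] dpoly_V diff_Suc_1)
qed

end
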